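(* For every integer $\ell \ge 1$, the difference $c_\ell(G) - c'_\ell(G)$ can be arbitrarily large; that is, for every integer $\ell \ge 1$ and every positive integer $N$ there exists a graph $G$ with $c_\ell(G) - c'_\ell(G) \ge N$.
   Context: Graphs are finite and simple. $\ell$-visibility Cops and Robbers on a graph $G$ ($\ell$ a nonnegative integer): a team of one or more cops and a single robber occupy vertices of $G$ (several cops may share a vertex). First the cops choose initial positions, then the robber, knowing them, chooses his. Thereafter the game proceeds in rounds, each a cop turn (each cop stays or moves to an adjacent vertex) followed by a robber turn (the robber stays or moves to an adjacent vertex). The robber always knows the cops' positions. The robber's position is unknown to the cops unless some cop is at distance at most $\ell$ from him; in that case the cops see the robber and all cops know his position. The robber is captured if a cop ever occupies the same vertex as he does. $c_\ell(G)$ denotes the minimum number of cops having a strategy (depending only on the information available to the cops) that guarantees capture of the robber within a finite number of rounds, regardless of how the robber plays; equivalently, one may suppose the robber is omniscient, i.e. able to anticipate the cops' moves and respond optimally. $c'_\ell(G)$ denotes the minimum number of cops having a strategy that guarantees, in the same sense, that some cop eventually sees the robber (is at distance at most $\ell$ from him), without necessarily capturing him. *)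

theory Defs
  imports "Graph_Theory.Shortest_Path"
begin

text \<open>
  A finite simple graph is an instance of the locale \<^locale>\<open>graph\<close> (a finite symmetric digraph
  without loops and parallel arcs). The positions of a team of k cops are given by a list of k
  vertices, so several cops may share a vertex. The cops are numbered by their indices in the list.
\<close>

definition sees :: "('a, 'b) pre_digraph \<Rightarrow> nat \<Rightarrow> 'a list \<Rightarrow> 'a \<Rightarrow> bool" where
  "sees G l cs r \<longleftrightarrow> (\<exists>c \<in> set cs. wf_digraph.\<mu> G (\<lambda>_. 1) c r \<le> ereal (real l))"

definition view :: "('a, 'b) pre_digraph \<Rightarrow> nat \<Rightarrow> 'a list \<Rightarrow> 'a \<Rightarrow> 'a option" where
  "view G l cs r = (if sees G l cs r then Some r else None)"

definition step :: "('a, 'b) pre_digraph \<Rightarrow> 'a \<Rightarrow> 'a \<Rightarrow> bool" where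
  "step G u v \<longleftrightarrow> v = u \<or> u \<rightarrow>\<^bsub>G\<^esub> v"

definition robber_play :: "('a, 'b) pre_digraph \<Rightarrow> (nat \<Rightarrow> 'a) \<Rightarrow> bool" where
  "robber_play G r \<longleftrightarrow> r 0 \<in> verts G \<and> (\<forall>t. step G (r t) (r (Suc t)))"

text \<open>
  A strategy maps the list of everything the cops have been told about the robber so far, oldest
  entry first, to the positions they occupy next. It need not take the cops' own past positions as
  an argument, as these are determined by the strategy and the list.
  The cops obtain one entry after the initial placement and then two entries per round, one after
  the cop turn and one after the robber turn.
\<close>

type_synonym 'a strategy = "'a option list \<Rightarrow> 'a list"

primrec history ::
    "('a, 'b) pre_digraph \<Rightarrow> nat \<Rightarrow> 'a strategy \<Rightarrow> (nat \<Rightarrow> 'a) \<Rightarrow> nat \<Rightarrow> 'a option list" where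
  "history G l \<sigma> r 0 = [view G l (\<sigma> []) (r 0)]"
| "history G l \<sigma> r (Suc t) =
     (let h = history G l \<sigma> r t
      in h @ [view G l (\<sigma> h) (r t), view G l (\<sigma> h) (r (Suc t))])"

primrec cops_at ::
    "('a, 'b) pre_digraph \<Rightarrow> nat \<Rightarrow> 'a strategy \<Rightarrow> (nat \<Rightarrow> 'a) \<Rightarrow> nat \<Rightarrow> 'a list" where
  "cops_at G l \<sigma> r 0 = \<sigma> []"
| "cops_at G l \<sigma> r (Suc t) = \<sigma> (history G l \<sigma> r t)"

definition cop_strategy :: "('a, 'b) pre_digraph \<Rightarrow> nat \<Rightarrow> nat \<Rightarrow> 'a strategy \<Rightarrow> bool" where
  "cop_strategy G l k \<sigma> \<longleftrightarrow>
     length (\<sigma> []) = k \<and> set (\<sigma> []) \<subseteq> verts G \<and>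
     (\<forall>r t. robber_play G r \<longrightarrow>
        list_all2 (step G) (cops_at G l \<sigma> r t) (cops_at G l \<sigma> r (Suc t)))"

text \<open>
  The goal \<open>P cs r\<close> is a condition on the positions \<open>cs\<close> of the cops and \<open>r\<close> of the robber. It may be
  met after the initial placement, after a cop turn or after a robber turn. Against a fixed
  strategy of the cops, an omniscient robber can realise exactly the sequences of moves given by
  \<^const>\<open>robber_play\<close>.
\<close>

definition can_force ::
    "('a, 'b) pre_digraph \<Rightarrow> nat \<Rightarrow> ('a list \<Rightarrow> 'a \<Rightarrow> bool) \<Rightarrow> nat \<Rightarrow> bool" where
  "can_force G l P k \<longleftrightarrow>
     (\<exists>\<sigma>. cop_strategy G l k \<sigma> \<and>
        (\<forall>r. robber_play G r \<longrightarrow>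
           (\<exists>t. P (cops_at G l \<sigma> r t) (r t) \<or> P (cops_at G l \<sigma> r (Suc t)) (r t))))"

definition capture_number :: "('a, 'b) pre_digraph \<Rightarrow> nat \<Rightarrow> nat" where
  "capture_number G l = (LEAST k. 1 \<le> k \<and> can_force G l (\<lambda>cs r. r \<in> set cs) k)"

definition sighting_number :: "('a, 'b) pre_digraph \<Rightarrow> nat \<Rightarrow> nat" where
  "sighting_number G l = (LEAST k. 1 \<le> k \<and> can_force G l (sees G l) k)"

text \<open>
  Both minima are attained on every nonempty finite graph: one cop on each vertex suffices.
\<close>

lemma can_force_card_verts:
  assumes "graph G" and "verts G \<noteq> {}"
  shows "1 \<le> card (verts G)"
    and "can_force G l (\<lambda>cs r. r \<in> set cs) (card (verts G))"
    and "can_force G l (sees G l) (card (verts G))"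
proof -
  interpret graph G by fact
  show "1 \<le> card (verts G)"
    using assms(2) by (simp add: Suc_le_eq card_gt_0_iff)
  obtain vs where vs: "set vs = verts G" "distinct vs"
    using finite_distinct_list[OF finite_verts] by blast
  have len: "length vs = card (verts G)"
    using vs distinct_card by metis
  have at: "cops_at G l (\<lambda>_. vs) r t = vs" for r t
    by (cases t) auto
  have strat: "cop_strategy G l (card (verts G)) (\<lambda>_. vs)"
    using len vs unfolding cop_strategy_def at by (simp add: list_all2_same step_def)
  show cap: "can_force G l (\<lambda>cs r. r \<in> set cs) (card (verts G))"
    unfolding can_force_def
    by (intro exI[of _ "\<lambda>_. vs"] conjI strat) (simp add: at vs robber_play_def, blast)
  have "sees G l vs v" if "v \<in> verts G" for v
    unfolding sees_def
  proof (rule bexI)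
    have "\<mu> (\<lambda>_. 1) v v \<le> awalk_cost (\<lambda>_. 1) []"
      using that by (intro min_cost_le_walk_cost) (simp add: awalk_Nil_iff)
    also have "\<dots> \<le> ereal (real l)" by simp
    finally show "\<mu> (\<lambda>_. 1) v v \<le> ereal (real l)" .
  qed (use that vs in simp)
  then show "can_force G l (sees G l) (card (verts G))"
    unfolding can_force_def
    by (intro exI[of _ "\<lambda>_. vs"] conjI strat) (simp add: at robber_play_def, blast)
qed

end

theory Submission
  imports Defs
begin

text \<open>
  Seeing the robber once can take half as many cops as catching him. Suppose that the ends of \<open>M\<close>
  disjoint edges dominate \<open>G\<close>. Then \<open>M\<close> cops, one on each of these edges, see the robber: they
  start at one end and cross to the other in the first cop turn. The robber does not move in
  between, and since the two placements together dominate \<open>G\<close>, his initial vertex is within distance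
  1 of a cop before or after that turn (\<open>sighting_number_le\<close>).

  On the other hand, if \<open>G\<close> has no triangle and no 4-cycle, then a cop who is not on the robber's
  vertex threatens at most one neighbour of it. So if every vertex has more than \<open>k\<close> neighbours,
  then \<open>k\<close> cops never catch the robber, even if they see him all the time (\<open>capture_number_gt\<close>).

  It remains to find a graph of girth at least 5 and minimum degree at least \<open>2 * M - 1\<close> that is
  dominated by the ends of \<open>M\<close> disjoint edges; the difference of the two numbers is then at least
  \<open>M - 1\<close>. Take \<open>2 * M\<close> hubs, joined in pairs by \<open>M\<close> edges, and give each hub the same large number
  of leaves, labelled by sets of sets of hubs. If the hubs \<open>i\<close> and \<open>j\<close> are not partners, match the
  leaves of \<open>i\<close> with those of \<open>j\<close> by toggling the membership of the pair \<open>{i, j}\<close> in the label. Along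
  a closed walk through leaves every pair is toggled an even number of times, which excludes
  triangles and forces a closed walk of length 4 to retrace its steps. The neighbours of a leaf are
  its hub and one match for each of the \<open>2 * M - 2\<close> hubs other than its hub and the partner of its
  hub.
\<close>

lemma step_refl [simp]: "step G v v"
  by (simp add: step_def)

lemma (in wf_digraph) step_in_verts: "step G u v \<Longrightarrow> u \<in> verts G \<Longrightarrow> v \<in> verts G"
  by (auto simp: step_def)

lemma (in wf_digraph) steps_in_verts:
  "list_all2 (step G) cs ds \<Longrightarrow> set cs \<subseteq> verts G \<Longrightarrow> set ds \<subseteq> verts G"
  by (induction rule: list_all2_induct) (auto simp: step_in_verts)

section \<open>Evading capture\<close>

text \<open>
  The play of a robber who answers every cop turn by the rule \<open>flee\<close>. The cops' next positions are a
  function of their history, which in turn depends on the robber's moves so far; the recursion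
  therefore builds the history and the robber's position together.
\<close>

primrec run :: "('a, 'b) pre_digraph \<Rightarrow> nat \<Rightarrow> 'a strategy \<Rightarrow> ('a list \<Rightarrow> 'a \<Rightarrow> 'a) \<Rightarrow> 'a \<Rightarrow>
    nat \<Rightarrow> 'a option list \<times> 'a" where
  "run G l \<sigma> flee v 0 = ([view G l (\<sigma> []) v], v)"
| "run G l \<sigma> flee v (Suc t) =
     (let (h, u) = run G l \<sigma> flee v t; w = flee (\<sigma> h) u
      in (h @ [view G l (\<sigma> h) u, view G l (\<sigma> h) w], w))"

lemma history_run:
  "history G l \<sigma> (\<lambda>t. snd (run G l \<sigma> flee v t)) t = fst (run G l \<sigma> flee v t)"
  by (induction t) (simp_all add: Let_def case_prod_beta)

text \<open>
  The robber keeps the invariant that after each of his turns no cop can step onto him. The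
  hypothesis \<open>escape\<close> works against any placement, so he can do this even against cops who always
  know where he is. For his initial choice he pretends to stand on an unoccupied vertex, which exists
  since there are fewer cops than vertices, and to flee from there.
\<close>

lemma not_can_force_capture:
  fixes G :: "('a, 'b) pre_digraph"
  assumes "wf_digraph G" and k: "k < card (verts G)"
    and escape: "\<And>cs v. length cs = k \<Longrightarrow> v \<in> verts G \<Longrightarrow> v \<notin> set cs \<Longrightarrow>
                   \<exists>u. step G v u \<and> (\<forall>c \<in> set cs. \<not> step G c u)"
  shows "\<not> can_force G l (\<lambda>cs r. r \<in> set cs) k"
proof
  interpret wf_digraph G by fact
  assume "can_force G l (\<lambda>cs r. r \<in> set cs) k"
  then obtain \<sigma> where \<sigma>: "cop_strategy G l k \<sigma>"
    and caught: "\<And>r. robber_play G r \<Longrightarrow>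
      \<exists>t. r t \<in> set (cops_at G l \<sigma> r t) \<or> r t \<in> set (cops_at G l \<sigma> r (Suc t))"
    unfolding can_force_def by blast
  have len0: "length (\<sigma> []) = k"
    using \<sigma> by (simp add: cop_strategy_def)
  have "\<not> verts G \<subseteq> set (\<sigma> [])"
  proof
    assume "verts G \<subseteq> set (\<sigma> [])"
    then have "card (verts G) \<le> length (\<sigma> [])"
      by (meson List.finite_set card_length card_mono le_trans)
    then show False
      using k len0 by simp
  qed
  then obtain x where "x \<in> verts G" "x \<notin> set (\<sigma> [])"
    by blast
  then obtain v where v: "v \<in> verts G" "\<forall>c \<in> set (\<sigma> []). \<not> step G c v"
    using escape[OF len0] step_in_verts by blast
  define safe where "safe cs u w \<longleftrightarrow> step G u w \<and> (\<forall>c \<in> set cs. \<not> step G c w)" for cs u w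
  \<comment> \<open>The default of staying put makes the run a legal play before anything is known about the cops'
      moves; they are only bound to legal moves against legal plays.\<close>
  define flee where "flee cs u = (if \<exists>w. safe cs u w then SOME w. safe cs u w else u)" for cs u
  have flee: "safe cs u (flee cs u)" if "\<exists>w. safe cs u w" for cs u
    using someI_ex[OF that] that by (simp add: flee_def)
  have flee_step: "step G u (flee cs u)" for cs u
  proof (cases "\<exists>w. safe cs u w")
    case True
    then show ?thesis using flee safe_def by blast
  qed (simp add: flee_def)
  have flee_safe: "safe cs u (flee cs u)" if "length cs = k" "u \<in> verts G" "u \<notin> set cs" for cs u
    by (rule flee) (use escape[OF that] in \<open>simp add: safe_def\<close>)
  define r where "r t = snd (run G l \<sigma> flee v t)" for t
  have hist: "history G l \<sigma> r t = fst (run G l \<sigma> flee v t)" for t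
    unfolding r_def by (rule history_run)
  have r_Suc: "r (Suc t) = flee (cops_at G l \<sigma> r (Suc t)) (r t)" for t
    by (simp add: hist) (simp add: r_def Let_def case_prod_beta)
  have play: "robber_play G r"
    unfolding robber_play_def r_Suc using v flee_step by (simp add: r_def)
  have steps: "list_all2 (step G) (cops_at G l \<sigma> r t) (cops_at G l \<sigma> r (Suc t))" for t
    using \<sigma> play unfolding cop_strategy_def by blast
  have len: "length (cops_at G l \<sigma> r t) = k" for t
    by (induction t) (use len0 list_all2_lengthD[OF steps] in auto)
  have r_verts: "r t \<in> verts G" for t
    by (induction t) (use play step_in_verts in \<open>auto simp: robber_play_def\<close>)
  have free: "r t \<notin> set (cops_at G l \<sigma> r (Suc t))"
    if "\<forall>c \<in> set (cops_at G l \<sigma> r t). \<not> step G c (r t)" for t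
  proof
    assume "r t \<in> set (cops_at G l \<sigma> r (Suc t))"
    then obtain c where "c \<in> set (cops_at G l \<sigma> r t)" "step G c (r t)"
      using steps[of t] by (metis in_set_conv_nth list_all2_conv_all_nth)
    with that show False by blast
  qed
  have inv: "\<forall>c \<in> set (cops_at G l \<sigma> r t). \<not> step G c (r t)" for t
  proof (induction t)
    case 0
    show ?case using v by (simp add: r_def)
  next
    case (Suc t)
    show ?case
      using flee_safe[OF len r_verts free[OF Suc]] unfolding r_Suc safe_def by blast
  qed
  from caught[OF play] obtain t where
    "r t \<in> set (cops_at G l \<sigma> r t) \<or> r t \<in> set (cops_at G l \<sigma> r (Suc t))" by blast
  then show False
    using inv[of t] free[OF inv] step_refl by metis
qed

text \<open>
  The hypothesis \<open>girth\<close> excludes triangles (a cop at \<open>u\<close> adjacent to \<open>w\<close>) and 4-cycles (a cop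
  adjacent to both).
  If all neighbours of the robber's vertex were threatened, assigning to each of them a cop
  threatening it would be injective, so there would be at least as many cops as neighbours.
\<close>

lemma capture_number_gt:
  fixes G :: "('a, 'b) pre_digraph"
  assumes "graph G" and "verts G \<noteq> {}"
    and degree: "\<And>v. v \<in> verts G \<Longrightarrow> k < card {u. v \<rightarrow>\<^bsub>G\<^esub> u}"
    and girth: "\<And>v c u w. v \<rightarrow>\<^bsub>G\<^esub> u \<Longrightarrow> v \<rightarrow>\<^bsub>G\<^esub> w \<Longrightarrow> c \<noteq> v \<Longrightarrow> step G c u \<Longrightarrow> step G c w \<Longrightarrow> u = w"
  shows "k < capture_number G l"
proof (rule ccontr)
  interpret graph G by fact
  assume "\<not> k < capture_number G l"
  then have le: "capture_number G l \<le> k" by simp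
  obtain v where "v \<in> verts G"
    using assms(2) by blast
  have "k < card {u. v \<rightarrow>\<^bsub>G\<^esub> u}"
    by (rule degree) fact
  also have "\<dots> \<le> card (verts G)"
    by (rule card_mono[OF finite_verts]) (use adj_in_verts in blast)
  finally have card: "capture_number G l < card (verts G)"
    using le by simp
  have "\<not> can_force G l (\<lambda>cs r. r \<in> set cs) (capture_number G l)"
  proof (rule not_can_force_capture[OF wf_digraph_axioms card])
    fix cs v
    assume cs: "length cs = capture_number G l" and v: "v \<in> verts G" "v \<notin> set cs"
    show "\<exists>u. step G v u \<and> (\<forall>c \<in> set cs. \<not> step G c u)"
    proof (rule ccontr)
      assume "\<not> ?thesis"
      then have "\<forall>u \<in> {u. v \<rightarrow>\<^bsub>G\<^esub> u}. \<exists>c \<in> set cs. step G c u"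
        by (auto simp: step_def)
      then obtain f where f: "\<And>u. v \<rightarrow>\<^bsub>G\<^esub> u \<Longrightarrow> f u \<in> set cs \<and> step G (f u) u"
        unfolding Ball_def Bex_def by (metis mem_Collect_eq)
      have "inj_on f {u. v \<rightarrow>\<^bsub>G\<^esub> u}"
      proof (rule inj_onI)
        fix u w assume "u \<in> {u. v \<rightarrow>\<^bsub>G\<^esub> u}" "w \<in> {u. v \<rightarrow>\<^bsub>G\<^esub> u}" "f u = f w"
        then show "u = w"
          using girth[of v u w "f u"] f[of u] f[of w] v(2) by (metis mem_Collect_eq)
      qed
      moreover have "f ` {u. v \<rightarrow>\<^bsub>G\<^esub> u} \<subseteq> set cs"
        using f by blast
      ultimately have "card {u. v \<rightarrow>\<^bsub>G\<^esub> u} \<le> card (set cs)"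
        by (rule card_inj_on_le) simp
      also have "\<dots> \<le> k"
        using card_length[of cs] cs le by simp
      finally show False
        using degree[OF v(1)] by simp
    qed
  qed
  moreover have "can_force G l (\<lambda>cs r. r \<in> set cs) (capture_number G l)"
    unfolding capture_number_def
    by (rule LeastI2[where a = "card (verts G)"])
      (use can_force_card_verts[OF assms(1,2)] in auto)
  ultimately show False by blast
qed

section \<open>Sighting the robber\<close>

lemma (in wf_digraph) sees_if_step:
  assumes "1 \<le> l" and "c \<in> set cs" and "c \<in> verts G" and "step G c v"
  shows "sees G l cs v"
proof -
  have "\<exists>p. awalk c p v \<and> length p \<le> 1"
  proof (cases "v = c")
    case True
    then show ?thesis using assms(3) by (intro exI[of _ "[]"]) (simp add: awalk_Nil_iff)
  next
    case False
    then obtain e where "e \<in> arcs G" "tail G e = c" "head G e = v"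
      using assms(4) by (auto simp: step_def arcs_ends_conv)
    then show ?thesis using arc_implies_awalk by (intro exI[of _ "[e]"]) auto
  qed
  then obtain p where p: "awalk c p v" "length p \<le> 1" by blast
  have "\<mu> (\<lambda>_. 1) c v \<le> awalk_cost (\<lambda>_. 1) p"
    using p(1) by (rule min_cost_le_walk_cost)
  also have "awalk_cost (\<lambda>_. 1) p = real (length p)"
    by (induction p) simp_all
  also have "ereal (real (length p)) \<le> ereal (real l)"
    using p(2) assms(1) by simp
  finally show ?thesis
    using assms(2) unfolding sees_def by blast
qed

text \<open>
  The cops wait at \<open>cs\<close> for the initial information and move to \<open>ds\<close> regardless of what it
  is. The robber gets no turn in between, hence each vertex needs to be near only one of the two
  placements.
\<close>

lemma sighting_number_le:
  assumes "wf_digraph G" and "1 \<le> l" and "cs \<noteq> []" and cs: "set cs \<subseteq> verts G"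
    and cds: "list_all2 (step G) cs ds"
    and dom: "\<And>v. v \<in> verts G \<Longrightarrow> \<exists>c \<in> set cs \<union> set ds. step G c v"
  shows "sighting_number G l \<le> length cs"
proof -
  interpret wf_digraph G by fact
  define \<sigma> where "\<sigma> h = (if h = [] then cs else ds)" for h :: "'a option list"
  have "history G l \<sigma> r t \<noteq> []" for r t
    by (cases t) (simp_all add: Let_def)
  then have at: "cops_at G l \<sigma> r 0 = cs" "cops_at G l \<sigma> r (Suc t) = ds" for r t
    by (simp_all add: \<sigma>_def)
  have strat: "cop_strategy G l (length cs) \<sigma>"
    unfolding cop_strategy_def
  proof (intro conjI allI impI)
    show "list_all2 (step G) (cops_at G l \<sigma> r t) (cops_at G l \<sigma> r (Suc t))" for r t
      by (cases t) (simp_all add: at cds list_all2_same del: cops_at.simps)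
  qed (use cs in \<open>simp_all add: \<sigma>_def\<close>)
  have ds: "set ds \<subseteq> verts G"
    using steps_in_verts[OF cds cs] .
  have "sees G l cs v \<or> sees G l ds v" if v: "v \<in> verts G" for v
  proof -
    obtain c where c: "c \<in> set cs \<or> c \<in> set ds" "step G c v"
      using dom[OF v] by blast
    then show ?thesis
      using sees_if_step[OF \<open>1 \<le> l\<close>] cs ds by (metis subsetD)
  qed
  then have "can_force G l (sees G l) (length cs)"
    unfolding can_force_def
    by (intro exI[of _ \<sigma>] conjI strat allI impI exI[of _ 0])
      (simp add: at robber_play_def del: cops_at.simps)
  then show ?thesis
    unfolding sighting_number_def using \<open>cs \<noteq> []\<close> by (intro Least_le) (simp add: Suc_le_eq)
qed

section \<open>A graph of girth 5 dominated by a matching\<close>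

datatype vertex = Hub nat | Leaf nat "nat set set"

text \<open>
  Hubs \<open>2 * j\<close> and \<open>2 * j + 1\<close> are partners. Their leaves must not be matched, since the edge
  between the hubs would then close 4-cycles.
\<close>

fun adj :: "vertex \<Rightarrow> vertex \<Rightarrow> bool" where
  "adj (Hub i) (Hub j) \<longleftrightarrow> i \<noteq> j \<and> i div 2 = j div 2"
| "adj (Hub i) (Leaf j Y) \<longleftrightarrow> i = j"
| "adj (Leaf i X) (Hub j) \<longleftrightarrow> i = j"
| "adj (Leaf i X) (Leaf j Y) \<longleftrightarrow> i div 2 \<noteq> j div 2 \<and> Y = sym_diff X {{i, j}}"

lemma adj_sym: "adj u v \<Longrightarrow> adj v u"
  by (cases u; cases v) (auto simp: insert_commute)

lemma adj_irrefl: "\<not> adj v v"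
  by (cases v) auto

lemma partner_unique:
  fixes i j k :: nat
  assumes "i \<noteq> j" "i \<noteq> k" "i div 2 = j div 2" "i div 2 = k div 2"
  shows "j = k"
proof -
  have "n = 2 * (n div 2) \<or> n = 2 * (n div 2) + 1" for n :: nat
    by linarith
  from this[of i] this[of j] this[of k] show ?thesis
    using assms by auto
qed

text \<open>
  Toggling changes the parity of the symmetric difference to \<open>X\<close>. A triangle of leaves would yield
  a label reached from \<open>X\<close> both by one toggle and by two.
\<close>

lemma toggle_three: "sym_diff (sym_diff X {a}) {b} \<noteq> sym_diff X {c}"
  by blast

text \<open>
  The first premise says that \<open>X\<close> and \<open>Z\<close> differ by toggling \<open>a\<close> and \<open>c\<close>, the second that they
  differ by toggling \<open>b\<close> and \<open>d\<close>; so either the toggles of each premise cancel or both premises toggle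
  the same two elements.
\<close>

lemma toggle_four:
  assumes "sym_diff X {a} = sym_diff Z {c}" "sym_diff X {b} = sym_diff Z {d}"
  shows "a = c \<and> X = Z \<or> a = b \<or> a = d \<and> b = c"
proof -
  have mem: "\<And>t. (t \<in> X) \<noteq> (t = a) \<longleftrightarrow> (t \<in> Z) \<noteq> (t = c)"
    "\<And>t. (t \<in> X) \<noteq> (t = b) \<longleftrightarrow> (t \<in> Z) \<noteq> (t = d)"
    using assms by (auto simp: set_eq_iff)
  show ?thesis
    using mem(1)[of a] mem(1)[of b] mem(1)[of c] mem(2)[of a] mem(2)[of b] mem(2)[of c] mem
    by (metis (no_types, opaque_lifting) subsetI subset_antisym)
qed

lemma adj_triangle_free: "adj v u \<Longrightarrow> adj v w \<Longrightarrow> \<not> adj u w"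
  by (cases v; cases u; cases w)
    (simp_all add: toggle_three[symmetric], metis partner_unique)

text \<open>
  The pairs toggled along the closed walk cancel as in \<open>toggle_four\<close>. Two consecutive steps
  toggle the same pair only if the second undoes the first; and if opposite steps toggle the same
  pairs, then consecutive ones do as well, because the hubs of adjacent leaves are different.
\<close>

lemma square_of_leaves:
  assumes "adj (Leaf i X) (Leaf j Y)" "adj (Leaf i X) (Leaf k W)"
    and "adj (Leaf m Z) (Leaf j Y)" "adj (Leaf m Z) (Leaf k W)"
  shows "Leaf i X = Leaf m Z \<or> Leaf j Y = Leaf k W"
proof -
  have "{i,j} = {m,j} \<and> X = Z \<or> {i,j} = {i,k} \<or> {i,j} = {m,k} \<and> {i,k} = {m,j}"
    by (rule toggle_four) (use assms in auto)
  then show ?thesis using assms by (auto simp: doubleton_eq_iff)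
qed

text \<open>
  Each vertex other than hub \<open>i\<close> is adjacent to at most one vertex among the leaves of \<open>i\<close>
  and the partner of \<open>i\<close>, because the leaves of \<open>i\<close> are joined to those of another hub by a matching, or,
  in the case of the partner of \<open>i\<close>, not at all.
\<close>

lemma square_at_hub:
  assumes "adj (Hub i) u" "adj (Hub i) w" "adj c u" "adj c w" "c \<noteq> Hub i"
  shows "u = w"
  using assms by (cases c; cases u; cases w) (auto dest: partner_unique)

text \<open>
  The vertices \<open>v\<close>, \<open>u\<close>, \<open>c\<close>, \<open>w\<close> form a cycle in this order. Rotating it reduces any cycle
  through a hub to one that starts at a hub.
\<close>

lemma adj_square_free:
  assumes "adj v u" "adj v w" "adj c u" "adj c w" "c \<noteq> v"
  shows "u = w"
proof (cases "\<exists>i. Hub i \<in> {v, u, c, w}")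
  case True
  then obtain i where "v = Hub i \<or> c = Hub i \<or> u = Hub i \<or> w = Hub i"
    by blast
  then show ?thesis
  proof (elim disjE)
    assume "v = Hub i"
    then show ?thesis using square_at_hub[of i u w c] assms by simp
  next
    assume "c = Hub i"
    then show ?thesis using square_at_hub[of i u w v] assms by simp
  next
    assume "u = Hub i"
    then show ?thesis using square_at_hub[of i v c w] assms adj_sym by metis
  next
    assume "w = Hub i"
    then show ?thesis using square_at_hub[of i v c u] assms adj_sym by metis
  qed
next
  case False
  then obtain i X j Y k W m Z where "v = Leaf i X" "u = Leaf j Y" "w = Leaf k W" "c = Leaf m Z"
    by (metis insertCI vertex.exhaust)
  then show ?thesis
    using square_of_leaves assms by metis
qed

text \<open>
  Labels range over all sets of sets of hubs, not only sets of pairs, so that the labels form the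
  full power set of a finite set, which is closed under toggling.
\<close>

definition hubs_and_leaves :: "nat \<Rightarrow> vertex set" where
  "hubs_and_leaves M = Hub ` {..<2 * M} \<union> case_prod Leaf ` ({..<2 * M} \<times> Pow (Pow {..<2 * M}))"

lemma vertex_set_iff [simp]:
  "Hub i \<in> hubs_and_leaves M \<longleftrightarrow> i < 2 * M"
  "Leaf i X \<in> hubs_and_leaves M \<longleftrightarrow> i < 2 * M \<and> X \<subseteq> Pow {..<2 * M}"
  by (auto simp: hubs_and_leaves_def)

lemma finite_vertex_set: "finite (hubs_and_leaves M)"
  by (simp add: hubs_and_leaves_def)

lemma min_degree:
  assumes "v \<in> hubs_and_leaves M"
  shows "2 * M - 1 \<le> card {u \<in> hubs_and_leaves M. adj v u}"
proof -
  have fin: "finite {u \<in> hubs_and_leaves M. adj v u}" using finite_vertex_set by simp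
  show ?thesis
  proof (cases v)
    case (Hub i)
    have "card {..<2 * M} \<le> card {u \<in> hubs_and_leaves M. adj v u}"
      by (rule card_inj_on_le[OF _ _ fin, of "\<lambda>j. Leaf i {{j}}"])
        (use Hub assms in \<open>auto simp: inj_on_def\<close>)
    then show ?thesis by simp
  next
    case (Leaf i X)
    \<comment> \<open>\<open>p\<close> is the partner of hub \<open>i\<close>. Hub \<open>i\<close> has no match of the leaf, so the value of \<open>F\<close> at \<open>i\<close> is
        free to stand for the remaining neighbour, hub \<open>i\<close> itself.\<close>
    define p where "p = (if even i then i + 1 else i - 1)"
    have "i \<noteq> p" "i div 2 = p div 2"
      by (auto simp: p_def elim!: evenE oddE)
    then have p: "i div 2 \<noteq> j div 2" if "j \<noteq> p" "j \<noteq> i" for j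
      using that partner_unique by metis
    define F where "F j = (if j = i then Hub i else Leaf j (sym_diff X {{i, j}}))" for j
    have "inj_on F ({..<2 * M} - {p})"
      by (auto simp: F_def inj_on_def split: if_splits)
    moreover have "F ` ({..<2 * M} - {p}) \<subseteq> {u \<in> hubs_and_leaves M. adj v u}"
    proof (rule image_subsetI)
      fix j assume j: "j \<in> {..<2 * M} - {p}"
      have "sym_diff X {{i, j}} \<subseteq> insert {i, j} X" by blast
      also have "\<dots> \<subseteq> Pow {..<2 * M}"
        using Leaf assms j by simp
      finally show "F j \<in> {u \<in> hubs_and_leaves M. adj v u}"
        using Leaf assms j p by (simp add: F_def)
    qed
    ultimately have "card ({..<2 * M} - {p}) \<le> card {u \<in> hubs_and_leaves M. adj v u}"
      using fin by (rule card_inj_on_le)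
    moreover have "2 * M - 1 \<le> card ({..<2 * M} - {p})"
      using diff_card_le_card_Diff[of "{p}" "{..<2 * M}"] by simp
    ultimately show ?thesis by linarith
  qed
qed

theorem theorem5p1:
  fixes l N :: nat
  assumes "1 \<le> l" and "1 \<le> N"
  shows "\<exists>G :: (nat, nat \<times> nat) pre_digraph.
           graph G \<and> verts G \<noteq> {} \<and>
           int (capture_number G l) - int (sighting_number G l) \<ge> int N"
proof -
  define M where "M = Suc N"
  \<comment> \<open>The graph is carried over to the natural numbers along an injection \<open>f\<close> with inverse \<open>g\<close>.\<close>
  obtain f :: "vertex \<Rightarrow> nat" where f: "inj_on f (hubs_and_leaves M)"
    using finite_imp_inj_to_nat_seg[OF finite_vertex_set] by blast
  define g where "g = the_inv_into (hubs_and_leaves M) f"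
  have gf [simp]: "g (f v) = v" if "v \<in> hubs_and_leaves M" for v
    unfolding g_def using f that by (rule the_inv_into_f_f)
  define G :: "(nat, nat \<times> nat) pre_digraph" where
    "G = \<lparr>verts = f ` hubs_and_leaves M,
          arcs = {(x, y) \<in> f ` hubs_and_leaves M \<times> f ` hubs_and_leaves M. adj (g x) (g y)},
          tail = fst, head = snd\<rparr>"
  have verts: "verts G = f ` hubs_and_leaves M" by (simp add: G_def)
  have dom: "x \<rightarrow>\<^bsub>G\<^esub> y \<longleftrightarrow> x \<in> verts G \<and> y \<in> verts G \<and> adj (g x) (g y)" for x y
    by (auto simp: G_def arcs_ends_def arc_to_ends_def image_iff)
  have "graph G"
  proof
    show "finite (verts G)"
      by (simp add: verts finite_vertex_set)
    show "finite (arcs G)"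
      by (rule finite_subset[of _ "verts G \<times> verts G"]) (auto simp: G_def finite_vertex_set)
    show "symmetric G"
      unfolding symmetric_def sym_def dom using adj_sym by blast
  qed (auto simp: G_def arc_to_ends_def adj_irrefl inj_on_eq_iff[OF f])
  then interpret graph G .
  have "Hub 0 \<in> hubs_and_leaves M" by (simp add: M_def)
  then have ne: "verts G \<noteq> {}" unfolding verts by blast
  have stepf: "step G (f u) (f v)" if "u \<in> hubs_and_leaves M" "v \<in> hubs_and_leaves M" "v = u \<or> adj u v"
    for u v
    using that by (auto simp: step_def dom verts)
  have g_inj: "x = y" if "x \<in> verts G" "y \<in> verts G" "g x = g y" for x y
    using that by (auto simp: verts)
  have girth: "y = y'"
    if y: "x \<rightarrow>\<^bsub>G\<^esub> y" "x \<rightarrow>\<^bsub>G\<^esub> y'" and z: "z \<noteq> x" "step G z y" "step G z y'" for x y y' z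
  proof -
    have adj: "adj (g x) (g y)" "adj (g x) (g y')"
      using y by (simp_all add: dom)
    consider "z = y \<or> z = y'" | "z \<rightarrow>\<^bsub>G\<^esub> y" "z \<rightarrow>\<^bsub>G\<^esub> y'"
      using z by (auto simp: step_def)
    then show ?thesis
    proof cases
      case 1
      then have "y = y' \<or> adj (g y) (g y') \<or> adj (g y') (g y)"
        using z by (auto simp: step_def dom)
      then show ?thesis
        using adj adj_triangle_free by blast
    next
      case 2
      then have "g z \<noteq> g x"
        using z(1) y(1) g_inj adj_in_verts by metis
      then have "g y = g y'"
        using adj_square_free[OF adj, of "g z"] 2 dom by blast
      then show ?thesis
        using g_inj adj_in_verts y by metis
    qed
  qed
  have "2 * M - 2 < capture_number G l"
  proof (rule capture_number_gt[OF \<open>graph G\<close> ne])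
    fix x assume "x \<in> verts G"
    then obtain v where v: "v \<in> hubs_and_leaves M" "x = f v" by (auto simp: verts)
    have "{y. x \<rightarrow>\<^bsub>G\<^esub> y} = f ` {u \<in> hubs_and_leaves M. adj v u}"
      using v by (auto simp: dom verts)
    moreover have "inj_on f {u \<in> hubs_and_leaves M. adj v u}"
      using f by (rule inj_on_subset) blast
    ultimately have "card {y. x \<rightarrow>\<^bsub>G\<^esub> y} = card {u \<in> hubs_and_leaves M. adj v u}"
      by (simp add: card_image)
    then show "2 * M - 2 < card {y. x \<rightarrow>\<^bsub>G\<^esub> y}"
      using min_degree[OF v(1)] by (simp add: M_def)
  next
    fix x z y y'
    assume "x \<rightarrow>\<^bsub>G\<^esub> y" "x \<rightarrow>\<^bsub>G\<^esub> y'" "z \<noteq> x" "step G z y" "step G z y'"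
    then show "y = y'"
      by (rule girth)
  qed
  moreover have "sighting_number G l \<le> M"
  proof -
    define cs where "cs = map (\<lambda>j. f (Hub (2 * j))) [0..<M]"
    define ds where "ds = map (\<lambda>j. f (Hub (2 * j + 1))) [0..<M]"
    have "sighting_number G l \<le> length cs"
    proof (rule sighting_number_le[OF wf_digraph_axioms \<open>1 \<le> l\<close>])
      show "cs \<noteq> []" by (simp add: cs_def M_def)
      show "set cs \<subseteq> verts G" by (auto simp: cs_def verts)
      show "list_all2 (step G) cs ds"
        unfolding cs_def ds_def by (simp add: list_all2_conv_all_nth stepf)
      fix x assume "x \<in> verts G"
      then obtain v where v: "v \<in> hubs_and_leaves M" "x = f v" by (auto simp: verts)
      obtain i where i: "i < 2 * M" "v = Hub i \<or> adj (Hub i) v"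
        using v(1) by (cases v) auto
      have "f (Hub i) \<in> set cs \<union> set ds"
      proof (cases "even i")
        case True
        then obtain j where "i = 2 * j" by (rule evenE)
        then have "f (Hub i) \<in> set cs" using i(1) by (simp add: cs_def)
        then show ?thesis ..
      next
        case False
        then obtain j where "i = 2 * j + 1" by (rule oddE)
        then have "f (Hub i) \<in> set ds" using i(1) by (simp add: ds_def)
        then show ?thesis ..
      qed
      moreover have "step G (f (Hub i)) x"
        unfolding v(2) using i v(1) by (intro stepf) auto
      ultimately show "\<exists>c \<in> set cs \<union> set ds. step G c x" by blast
    qed
    then show ?thesis by (simp add: cs_def)
  qed
  ultimately have "int (capture_number G l) - int (sighting_number G l) \<ge> int N"
    by (simp add: M_def)
  then show ?thesis
    using \<open>graph G\<close> ne by blast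
qed

end
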